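(* If a graph $G$ does not contain $K_{2,3}$ as a minor, then $G$ does not contain an agile set of size $5$.
   Context: Graphs are simple and undirected. A pair $(X_1,X_2)$ of disjoint vertex sets of a graph $G$ is independent if there are two disjoint trees $T_1,T_2$ in $G$ such that $X_1\subseteq V(T_1)$ and $X_2\subseteq V(T_2)$ (partition classes may be empty, and if $X_i=\emptyset$ the corresponding $T_i$ may be taken empty). A set $X\subseteq V(G)$ is agile (in $G$) if for every partition $X=X_1\,\dot\cup\,X_2$ the pair $(X_1,X_2)$ is independent. *)

theory Defs
  imports Main
begin

record 'a ugraph =
  verts :: "'a set"
  edges :: "'a set set"

text \<open>Vertex sets are not required to be finite.\<close>

definition simple_graph :: "'a ugraph \<Rightarrow> bool" where
  "simple_graph G \<longleftrightarrow> (\<forall>e\<in>edges G. \<exists>u\<in>verts G. \<exists>v\<in>verts G. u \<noteq> v \<and> e = {u, v})"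

definition empty_graph :: "'a ugraph" where
  "empty_graph = \<lparr>verts = {}, edges = {}\<rparr>"

definition subgraph :: "'a ugraph \<Rightarrow> 'a ugraph \<Rightarrow> bool" where
  "subgraph H G \<longleftrightarrow> simple_graph H \<and> verts H \<subseteq> verts G \<and> edges H \<subseteq> edges G"

definition induced :: "'a ugraph \<Rightarrow> 'a set \<Rightarrow> 'a ugraph" where
  "induced G S = \<lparr>verts = verts G \<inter> S, edges = {e \<in> edges G. e \<subseteq> S}\<rparr>"

text \<open>A path is given by its sequence of vertices; a single vertex is a path.\<close>

definition is_path :: "'a ugraph \<Rightarrow> 'a list \<Rightarrow> bool" where
  "is_path G p \<longleftrightarrow> p \<noteq> [] \<and> distinct p \<and> set p \<subseteq> verts G \<and>
     successively (\<lambda>u v. {u, v} \<in> edges G) p"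

text \<open>A cycle is given by its cyclic sequence of vertices, the first one not being repeated at the end.\<close>

definition is_cycle :: "'a ugraph \<Rightarrow> 'a list \<Rightarrow> bool" where
  "is_cycle G c \<longleftrightarrow> is_path G c \<and> length c \<ge> 3 \<and> {last c, hd c} \<in> edges G"

text \<open>The empty graph is neither connected nor a tree.\<close>

definition connected_graph :: "'a ugraph \<Rightarrow> bool" where
  "connected_graph G \<longleftrightarrow> verts G \<noteq> {} \<and>
     (\<forall>u\<in>verts G. \<forall>v\<in>verts G. \<exists>p. is_path G p \<and> hd p = u \<and> last p = v)"

definition is_tree :: "'a ugraph \<Rightarrow> bool" where
  "is_tree T \<longleftrightarrow> simple_graph T \<and> connected_graph T \<and> (\<nexists>c. is_cycle T c)"

definition independent_pair :: "'a ugraph \<Rightarrow> 'a set \<Rightarrow> 'a set \<Rightarrow> bool" where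
  "independent_pair G X1 X2 \<longleftrightarrow> X1 \<subseteq> verts G \<and> X2 \<subseteq> verts G \<and> X1 \<inter> X2 = {} \<and>
     (\<exists>T1 T2. subgraph T1 G \<and> subgraph T2 G \<and>
        (is_tree T1 \<or> X1 = {} \<and> T1 = empty_graph) \<and>
        (is_tree T2 \<or> X2 = {} \<and> T2 = empty_graph) \<and>
        verts T1 \<inter> verts T2 = {} \<and>
        X1 \<subseteq> verts T1 \<and> X2 \<subseteq> verts T2)"

definition agile :: "'a ugraph \<Rightarrow> 'a set \<Rightarrow> bool" where
  "agile G X \<longleftrightarrow> X \<subseteq> verts G \<and>
     (\<forall>X1 X2. X1 \<union> X2 = X \<and> X1 \<inter> X2 = {} \<longrightarrow> independent_pair G X1 X2)"

text \<open>\<open>is_minor H G\<close>: \<open>H\<close> is a minor of \<open>G\<close>, witnessed by the family \<open>\<beta>\<close> of branch sets.\<close>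

definition is_minor :: "'b ugraph \<Rightarrow> 'a ugraph \<Rightarrow> bool" where
  "is_minor H G \<longleftrightarrow> (\<exists>\<beta> :: 'b \<Rightarrow> 'a set.
     (\<forall>x\<in>verts H. \<beta> x \<subseteq> verts G \<and> connected_graph (induced G (\<beta> x))) \<and>
     (\<forall>x\<in>verts H. \<forall>y\<in>verts H. x \<noteq> y \<longrightarrow> \<beta> x \<inter> \<beta> y = {}) \<and>
     (\<forall>x y. {x, y} \<in> edges H \<longrightarrow> (\<exists>u\<in>\<beta> x. \<exists>v\<in>\<beta> y. {u, v} \<in> edges G)))"

definition complete_bipartite :: "nat \<Rightarrow> nat \<Rightarrow> (nat + nat) ugraph" where
  "complete_bipartite m n =
     \<lparr>verts = Inl ` {..<m} \<union> Inr ` {..<n},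
      edges = {{Inl i, Inr j} | i j. i < m \<and> j < n}\<rparr>"

end

theory Submission
  imports Defs
begin

text \<open>
  Only the partitions into two and three vertices are needed, and the trees may be replaced by
  finite connected vertex sets, so that there is a smallest finite vertex set \<open>W\<close> carrying a 5-set
  all of whose 2|3-partitions are independent inside \<open>W\<close>. If removing at most one vertex \<open>v\<close>
  separated \<open>W\<close>, one side would contain at most one of the five vertices, since otherwise two
  disjoint connected sets would both have to pass through \<open>v\<close>; moving that vertex to \<open>v\<close> and deleting
  the side contradicts minimality. Hence \<open>W\<close> is 2-connected. A longest cycle of \<open>W\<close> then spans \<open>W\<close>:
  an ear on it either yields a longer cycle, if its ends are consecutive, or a \<open>K\<^sub>2\<^sub>,\<^sub>3\<close>. Finally, if
  the five vertices are \<open>x\<^sub>1, \<dots>, x\<^sub>5\<close> in cyclic order, then disjoint connected sets containing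
  \<open>x\<^sub>1, x\<^sub>3\<close> and \<open>x\<^sub>2, x\<^sub>4\<close> provide two crossing chords of a spanning cycle of length at least 5,
  and these give a \<open>K\<^sub>2\<^sub>,\<^sub>3\<close> minor.
\<close>

section \<open>Connected vertex sets\<close>

text \<open>Connectedness in cut form, for vertex sets instead of graphs. The empty set counts as
  connected, so arcs of a cycle and set differences need no case distinction.\<close>

definition conn :: "'a ugraph \<Rightarrow> 'a set \<Rightarrow> bool" where
  "conn G S \<longleftrightarrow> (\<forall>P. P \<subseteq> S \<longrightarrow> P \<noteq> {} \<longrightarrow> P \<noteq> S \<longrightarrow> (\<exists>a\<in>P. \<exists>b\<in>S - P. {a, b} \<in> edges G))"

lemma connD:
  assumes "conn G S" "a \<in> S" "a \<in> P" "b \<in> S" "b \<notin> P"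
  obtains u v where "u \<in> S" "u \<in> P" "v \<in> S" "v \<notin> P" "{u, v} \<in> edges G"
proof -
  have "S \<inter> P \<subseteq> S" "S \<inter> P \<noteq> {}" "S \<inter> P \<noteq> S" using assms by auto
  then obtain u v where "u \<in> S \<inter> P" "v \<in> S - S \<inter> P" "{u, v} \<in> edges G"
    using assms(1) unfolding conn_def by meson
  then show thesis using that by blast
qed

lemma conn_singleton: "conn G {x}"
  unfolding conn_def by blast

lemma conn_empty: "conn G {}"
  unfolding conn_def by blast

text \<open>If no edge leaves \<open>P\<close> inside the union, then \<open>P\<close> contains or
  misses each of \<open>S\<close> and \<open>T\<close> as a whole, and the link between
  \<open>s\<close> and \<open>t\<close> forces the same alternative for both.\<close>

lemma conn_Un:
  assumes "conn G S" "conn G T" "s \<in> S" "t \<in> T" "s = t \<or> {s, t} \<in> edges G"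
  shows "conn G (S \<union> T)"
  unfolding conn_def
proof (intro allI impI, rule ccontr)
  fix P assume P: "P \<subseteq> S \<union> T" "P \<noteq> {}" "P \<noteq> S \<union> T"
    and no: "\<not> (\<exists>a\<in>P. \<exists>b\<in>S \<union> T - P. {a, b} \<in> edges G)"
  have whole: "R \<subseteq> P \<or> R \<inter> P = {}" if R: "conn G R" "R \<subseteq> S \<union> T" for R
  proof (rule ccontr)
    assume "\<not> ?thesis"
    then obtain a b where ab: "a \<in> R" "a \<in> P" "b \<in> R" "b \<notin> P" by blast
    obtain u v where "u \<in> P" "v \<in> R" "v \<notin> P" "{u, v} \<in> edges G"
      by (rule connD[OF R(1) ab])
    then show False using no R(2) by blast
  qed
  have S: "S \<subseteq> P \<or> S \<inter> P = {}" and T: "T \<subseteq> P \<or> T \<inter> P = {}"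
    using whole[of S] whole[of T] assms(1,2) by auto
  have "s \<in> P \<longleftrightarrow> t \<in> P"
    using no assms(3-5) by (metis DiffI UnI1 UnI2 insert_commute)
  then show False using S T P assms(3,4) by blast
qed

lemma conn_Union:
  assumes "\<And>A. A \<in> F \<Longrightarrow> conn G A \<and> r \<in> A"
  shows "conn G (\<Union>F)"
  unfolding conn_def
proof (intro allI impI)
  fix P assume P: "P \<subseteq> \<Union>F" "P \<noteq> {}" "P \<noteq> \<Union>F"
  obtain a A where a: "a \<in> P" "a \<in> A" "A \<in> F" using P by blast
  obtain b B where b: "b \<notin> P" "b \<in> B" "B \<in> F" using P by blast
  show "\<exists>a\<in>P. \<exists>b\<in>\<Union>F - P. {a, b} \<in> edges G"
  proof (cases "r \<in> P")
    case True
    then show ?thesis using connD[of G B r P b] assms[OF b(3)] b by (metis DiffI UnionI)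
  next
    case False
    then show ?thesis using connD[of G A a P r] assms[OF a(3)] a by (metis DiffI UnionI)
  qed
qed

lemma conn_walk:
  assumes "successively (\<lambda>u v. {u, v} \<in> edges G) p"
  shows "conn G (set p)"
  using assms
proof (induction p rule: induct_list012)
  case (3 x y zs)
  then have "conn G ({x} \<union> set (y # zs))"
    by (intro conn_Un[where s = x and t = y]) (auto simp: conn_singleton)
  then show ?case by (simp add: insert_commute)
qed (simp_all add: conn_empty conn_singleton)

text \<open>\<open>T\<close> may be infinite. The paths in \<open>T\<close> from one fixed vertex of
  \<open>A\<close> to all vertices of \<open>A\<close> form a finite connected set, which makes a
  smallest carrier possible later.\<close>

lemma conn_finite_subset:
  assumes "connected_graph T" "edges T \<subseteq> edges G" "finite A" "A \<subseteq> verts T" "A \<noteq> {}"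
  shows "\<exists>F. finite F \<and> A \<subseteq> F \<and> F \<subseteq> verts T \<and> conn G F"
proof -
  obtain r where r: "r \<in> A" using assms by blast
  have "\<forall>a\<in>A. \<exists>p. is_path T p \<and> hd p = r \<and> last p = a"
    using assms r unfolding connected_graph_def by blast
  then obtain p where p: "\<And>a. a \<in> A \<Longrightarrow> is_path T (p a) \<and> hd (p a) = r \<and> last (p a) = a"
    by metis
  have "conn G (set (p a)) \<and> r \<in> set (p a) \<and> a \<in> set (p a) \<and> set (p a) \<subseteq> verts T" if "a \<in> A" for a
  proof -
    have "successively (\<lambda>u v. {u, v} \<in> edges G) (p a)"
      using p[OF that] assms(2) unfolding is_path_def by (metis (mono_tags, lifting) subsetD successively_mono)
    then show ?thesis using p[OF that] unfolding is_path_def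
      by (metis conn_walk hd_in_set last_in_set)
  qed
  then have "conn G (\<Union>((\<lambda>a. set (p a)) ` A))" "A \<subseteq> \<Union>((\<lambda>a. set (p a)) ` A)"
    "\<Union>((\<lambda>a. set (p a)) ` A) \<subseteq> verts T"
    by (auto intro!: conn_Union[where r = r])
  moreover have "finite (\<Union>((\<lambda>a. set (p a)) ` A))" using assms(3) by auto
  ultimately show ?thesis by blast
qed

text \<open>Otherwise an edge from \<open>a\<close> to \<open>b\<close> leaves the set of vertices
  reachable from \<open>u\<close>. A path to \<open>a\<close> is cut off at \<open>b\<close> if it
  contains \<open>b\<close>, and prolonged by \<open>b\<close> if not; either way \<open>b\<close>
  is reachable.\<close>

lemma conn_path:
  assumes "conn G S" "u \<in> S" "v \<in> S"
  shows "\<exists>p. p \<noteq> [] \<and> distinct p \<and> set p \<subseteq> S \<and> successively (\<lambda>u v. {u, v} \<in> edges G) p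
    \<and> hd p = u \<and> last p = v"
proof (rule ccontr)
  let ?path = "\<lambda>v p. p \<noteq> [] \<and> distinct p \<and> set p \<subseteq> S \<and> successively (\<lambda>u v. {u, v} \<in> edges G) p
    \<and> hd p = u \<and> last p = v"
  assume no: "\<nexists>p. ?path v p"
  define R where "R = {x. \<exists>p. ?path x p}"
  have "?path u [u]" using assms by simp
  then have "u \<in> R" unfolding R_def by blast
  moreover have "v \<notin> R" using no unfolding R_def by blast
  ultimately obtain a b where "a \<in> S" "a \<in> R" "b \<in> S" "b \<notin> R" "{a, b} \<in> edges G"
    using connD[OF assms(1,2) _ assms(3)] by metis
  then have ab: "\<exists>p. ?path a p" "b \<in> S" "\<nexists>p. ?path b p" "{a, b} \<in> edges G"
    unfolding R_def by blast+
  then obtain p where p: "?path a p" by blast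
  show False
  proof (cases "b \<in> set p")
    case True
    then obtain xs ys where "p = (xs @ [b]) @ ys" by (metis append.assoc append_Cons append_Nil split_list)
    then have "?path b (xs @ [b])"
      using p by (auto simp: successively_append_iff hd_append split: if_splits)
    then show False using ab by blast
  next
    case False
    then have "?path b (p @ [b])" using p ab by (auto simp: successively_append_iff)
    then show False using ab by blast
  qed
qed

lemma connected_graph_induced:
  assumes "conn G S" "S \<noteq> {}" "S \<subseteq> verts G"
  shows "connected_graph (induced G S)"
  unfolding connected_graph_def
proof (intro conjI ballI)
  show "verts (induced G S) \<noteq> {}" using assms by (auto simp: induced_def)
  fix u v assume "u \<in> verts (induced G S)" "v \<in> verts (induced G S)"
  then have "u \<in> S" "v \<in> S" by (auto simp: induced_def)
  then obtain p where p: "p \<noteq> []" "distinct p" "set p \<subseteq> S"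
    "successively (\<lambda>u v. {u, v} \<in> edges G) p" "hd p = u" "last p = v"
    using conn_path[OF assms(1)] by blast
  have "successively (\<lambda>u v. {u, v} \<in> edges (induced G S)) p"
    by (rule successively_mono[OF p(4)]) (use p(3) in \<open>auto simp: induced_def\<close>)
  then have "is_path (induced G S) p"
    unfolding is_path_def using p assms(3) by (auto simp: induced_def)
  then show "\<exists>p. is_path (induced G S) p \<and> hd p = u \<and> last p = v" using p by blast
qed

section \<open>Branch sets of a K_{2,3} minor\<close>

definition adj :: "'a ugraph \<Rightarrow> 'a set \<Rightarrow> 'a set \<Rightarrow> bool" where
  "adj G A B \<longleftrightarrow> (\<exists>a\<in>A. \<exists>b\<in>B. {a, b} \<in> edges G)"

lemma adjI: "a \<in> A \<Longrightarrow> b \<in> B \<Longrightarrow> {a, b} \<in> edges G \<Longrightarrow> adj G A B"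
  unfolding adj_def by blast

lemma adjI': "a \<in> A \<Longrightarrow> b \<in> B \<Longrightarrow> {b, a} \<in> edges G \<Longrightarrow> adj G A B"
  unfolding adj_def by (metis insert_commute)

text \<open>\<open>A0\<close> and \<open>A1\<close> are the branch sets of the side of size 2, the
  others those of the side of size 3. That all are nonempty follows from the adjacencies.\<close>

lemma K23_minorI:
  assumes G: "simple_graph G"
    and conn: "conn G A0" "conn G A1" "conn G B0" "conn G B1" "conn G B2"
    and disj: "A0 \<inter> A1 = {}" "A0 \<inter> B0 = {}" "A0 \<inter> B1 = {}" "A0 \<inter> B2 = {}"
      "A1 \<inter> B0 = {}" "A1 \<inter> B1 = {}" "A1 \<inter> B2 = {}"
      "B0 \<inter> B1 = {}" "B0 \<inter> B2 = {}" "B1 \<inter> B2 = {}"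
    and adj: "adj G A0 B0" "adj G A0 B1" "adj G A0 B2" "adj G A1 B0" "adj G A1 B1" "adj G A1 B2"
    and verts: "A0 \<subseteq> verts G" "A1 \<subseteq> verts G" "B0 \<subseteq> verts G" "B1 \<subseteq> verts G" "B2 \<subseteq> verts G"
  shows "is_minor (complete_bipartite 2 3) G"
proof -
  \<comment> \<open>Indices out of range fall back to \<open>A1\<close> and \<open>B2\<close>. Hence
    \<open>branch\<close>, \<open>ab\<close> and \<open>edge\<close> hold for all indices, and only
    \<open>aa\<close> and \<open>bb\<close> need bounds.\<close>
  define a where "a = (\<lambda>i::nat. if i = 0 then A0 else A1)"
  define b where "b = (\<lambda>i::nat. if i = 0 then B0 else if i = 1 then B1 else B2)"
  define \<beta> where "\<beta> = case_sum a b"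
  have lt2: "i < 2 \<longleftrightarrow> i = 0 \<or> i = 1" and lt3: "i < 3 \<longleftrightarrow> i = 0 \<or> i = 1 \<or> i = 2" for i :: nat
    by auto
  have ne: "A0 \<noteq> {}" "A1 \<noteq> {}" "B0 \<noteq> {}" "B1 \<noteq> {}" "B2 \<noteq> {}"
    using adj unfolding adj_def by auto
  have branch: "\<beta> x \<subseteq> verts G \<and> connected_graph (induced G (\<beta> x))" for x
    using verts conn ne connected_graph_induced[of G]
    by (cases x) (auto simp: \<beta>_def a_def b_def)
  have ab: "a i \<inter> b j = {}" for i j
    using disj by (simp add: a_def b_def)
  have aa: "a i \<inter> a j = {}" if "i < 2" "j < 2" "i \<noteq> j" for i j
    using that disj unfolding lt2 a_def by (elim disjE; simp add: Int_commute)
  have bb: "b i \<inter> b j = {}" if "i < 3" "j < 3" "i \<noteq> j" for i j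
    using that disj unfolding lt3 b_def by (elim disjE; simp add: Int_commute)
  have disjoint: "\<beta> x \<inter> \<beta> y = {}"
    if xy: "x \<in> verts (complete_bipartite 2 3)" "y \<in> verts (complete_bipartite 2 3)" "x \<noteq> y" for x y
  proof (cases x; cases y)
    fix i j assume "x = Inl i" "y = Inl j"
    then show ?thesis using aa[of i j] xy by (force simp: complete_bipartite_def \<beta>_def)
  next
    fix i j assume "x = Inl i" "y = Inr j"
    then show ?thesis using ab by (simp add: \<beta>_def)
  next
    fix i j assume "x = Inr i" "y = Inl j"
    then show ?thesis using ab by (simp add: \<beta>_def Int_commute)
  next
    fix i j assume "x = Inr i" "y = Inr j"
    then show ?thesis using bb[of i j] xy by (force simp: complete_bipartite_def \<beta>_def)
  qed
  have edge: "adj G (a i) (b j)" for i j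
    using adj by (auto simp: a_def b_def)
  then have edge': "adj G (b j) (a i)" for i j
    unfolding adj_def by (metis insert_commute)
  have edges: "\<exists>u\<in>\<beta> x. \<exists>v\<in>\<beta> y. {u, v} \<in> edges G" if "{x, y} \<in> edges (complete_bipartite 2 3)" for x y
  proof -
    from that obtain i j where "x = Inl i \<and> y = Inr j \<or> x = Inr j \<and> y = Inl i"
      by (auto simp: complete_bipartite_def doubleton_eq_iff)
    then have "adj G (\<beta> x) (\<beta> y)" using edge[of i j] edge'[of j i] unfolding \<beta>_def by auto
    then show ?thesis unfolding adj_def .
  qed
  show ?thesis unfolding is_minor_def
    by (intro exI[of _ \<beta>] conjI ballI allI impI) (simp_all add: branch disjoint edges)
qed

section \<open>Cycles as periodic sequences\<close>

text \<open>A cycle is a periodic sequence, so that it can be cut open at any position \<open>p\<close> and becomes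
  injective on the window \<open>{p..<p + n}\<close>. The degenerate length 2, an edge traversed back and forth,
  is allowed: extending cycles can then start from a single edge.\<close>

definition cyc :: "'a ugraph \<Rightarrow> nat \<Rightarrow> (nat \<Rightarrow> 'a) \<Rightarrow> bool" where
  "cyc G n f \<longleftrightarrow> 2 \<le> n \<and> (\<forall>i. f (i + n) = f i) \<and> inj_on f {..<n} \<and> (\<forall>i. {f i, f (Suc i)} \<in> edges G)"

lemma cyc_edge: "cyc G n f \<Longrightarrow> {f i, f (Suc i)} \<in> edges G"
  unfolding cyc_def by blast

lemma cyc_period: "cyc G n f \<Longrightarrow> f (i + n) = f i"
  unfolding cyc_def by blast

lemma cyc_mod:
  assumes "cyc G n f"
  shows "f (i mod n) = f i"
proof -
  have "f (i + k * n) = f i" for i k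
  proof (induction k)
    case (Suc k)
    have "f (i + Suc k * n) = f (i + k * n + n)" by (simp add: algebra_simps)
    then show ?case using Suc cyc_period[OF assms] by metis
  qed simp
  from this[of "i mod n" "i div n"] show ?thesis by simp
qed

lemma cyc_inj:
  assumes "cyc G n f"
  shows "inj_on f {p..<p + n}"
proof (rule linorder_inj_onI)
  fix i j assume ij: "i < j" "i \<in> {p..<p + n}" "j \<in> {p..<p + n}"
  have n: "inj_on f {..<n}" "n > 0" using assms unfolding cyc_def by auto
  show "f i \<noteq> f j"
  proof
    assume "f i = f j"
    then have "f (i mod n) = f (j mod n)" using cyc_mod[OF assms] by simp
    then have "i mod n = j mod n" using n by (simp add: inj_on_eq_iff)
    then have "n dvd j - i" using ij by (metis mod_eq_dvd_iff_nat less_imp_le)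
    then show False using ij by (auto dest!: dvd_imp_le)
  qed
qed (use less_linear in auto)

lemma cyc_range:
  assumes "cyc G n f"
  shows "range f = f ` {p..<p + n}"
proof (intro equalityI subsetI)
  fix x assume "x \<in> range f"
  then obtain i where x: "x = f i" by blast
  have n: "n > 0" using assms unfolding cyc_def by auto
  \<comment> \<open>\<open>k\<close> is the position in the window that is congruent to
    \<open>i\<close>. Adding \<open>p * n\<close> keeps the residue and makes the subtraction of
    \<open>p\<close> exact in the natural numbers.\<close>
  define k where "k = p + (i + p * n - p) mod n"
  have "p \<le> i + p * n" using n by (metis Suc_leI le_add2 le_trans mult.right_neutral mult_le_mono2 One_nat_def)
  then have "k mod n = i mod n" unfolding k_def by (simp add: mod_add_right_eq)
  then have "f k = x" using x cyc_mod[OF assms] by metis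
  moreover have "k \<in> {p..<p + n}" using n by (simp add: k_def)
  ultimately show "x \<in> f ` {p..<p + n}" by blast
qed blast

lemma cyc_verts:
  assumes "simple_graph G" "cyc G n f"
  shows "range f \<subseteq> verts G"
proof
  fix x assume "x \<in> range f"
  then obtain i where "x = f i" by blast
  then show "x \<in> verts G"
    using assms(1) cyc_edge[OF assms(2), of i] unfolding simple_graph_def
    by (metis doubleton_eq_iff)
qed

lemma cyc_conn:
  assumes "cyc G n f"
  shows "conn G (f ` {a..<b})"
proof (induction b)
  case 0
  then show ?case by (simp add: conn_empty)
next
  case (Suc b)
  show ?case
  proof (cases "a < b")
    case True
    then have "{a..<Suc b} = {a..<b} \<union> {b}" by auto
    moreover have "conn G (f ` {a..<b} \<union> {f b})"
      using True Suc cyc_edge[OF assms, of "b - 1"]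
      by (intro conn_Un[where s = "f (b - 1)" and t = "f b"]) (auto simp: conn_singleton)
    ultimately show ?thesis by (simp add: image_Un)
  next
    case False
    then have "{a..<Suc b} = (if a = b then {b} else {})" by auto
    then show ?thesis by (simp add: conn_empty conn_singleton)
  qed
qed

lemma cyc_disjoint:
  assumes "cyc G n f" "I \<subseteq> {p..<p + n}" "J \<subseteq> {p..<p + n}" "I \<inter> J = {}"
  shows "f ` I \<inter> f ` J = {}"
  using inj_on_image_Int[OF cyc_inj[OF assms(1)] assms(2,3)] assms(4) by simp

lemma cyc_of_list:
  assumes "distinct c" "length c \<ge> 2" "successively (\<lambda>u v. {u, v} \<in> edges G) c"
    "{last c, hd c} \<in> edges G"
  shows "cyc G (length c) (\<lambda>i. c ! (i mod length c))"
proof -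
  have "{c ! (i mod length c), c ! (Suc i mod length c)} \<in> edges G" for i
  proof (cases "Suc (i mod length c) = length c")
    case True
    then have "Suc i mod length c = 0" by (simp add: mod_Suc)
    moreover have "i mod length c = length c - 1" using True by simp
    moreover have "c \<noteq> []" using assms(2) by auto
    ultimately show ?thesis using assms(4) by (simp add: last_conv_nth hd_conv_nth)
  next
    case False
    have "i mod length c < length c" using assms(2) by (intro mod_less_divisor) auto
    then show ?thesis using assms(3) False by (auto simp: mod_Suc successively_conv_nth)
  qed
  moreover have "inj_on (\<lambda>i. c ! (i mod length c)) {..<length c}"
    using assms(1) by (auto simp: inj_on_def nth_eq_iff_index_eq)
  ultimately show ?thesis using assms(2) unfolding cyc_def by auto
qed

section \<open>Ears and crossing chords of a cycle\<close>

text \<open>The edge between \<open>f p\<close> and \<open>f (Suc p)\<close> is replaced by a path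
  through \<open>Q\<close>. This path has at least one vertex, so the cycle becomes longer;
  \<open>u = v\<close> and \<open>n = 2\<close> are covered as well.\<close>

lemma cyc_extend:
  assumes f: "cyc G n f" "range f \<subseteq> W"
    and Q: "conn G Q" "Q \<inter> range f = {}" "Q \<subseteq> W" "u \<in> Q" "v \<in> Q"
    and uv: "{f p, u} \<in> edges G" "{f (Suc p), v} \<in> edges G"
  shows "\<exists>m g. n < m \<and> cyc G m g \<and> range g \<subseteq> W"
proof -
  obtain q where q: "q \<noteq> []" "distinct q" "set q \<subseteq> Q"
    "successively (\<lambda>u v. {u, v} \<in> edges G) q" "hd q = u" "last q = v"
    using conn_path[OF Q(1,4,5)] by blast
  have n: "2 \<le> n" using f by (simp add: cyc_def)
  \<comment> \<open>\<open>r\<close> runs once around the cycle from \<open>f (Suc p)\<close> to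
    \<open>f (p + n)\<close>, which is \<open>f p\<close>. Then \<open>q\<close> leads from
    \<open>f p\<close> back to \<open>f (Suc p)\<close>.\<close>
  define r where "r = map f [Suc p..<Suc p + n]"
  have r: "r \<noteq> []" "length r = n" "hd r = f (Suc p)" "last r = f p"
    using n cyc_period[OF f(1), of p] by (auto simp: r_def hd_map last_map simp del: upt_Suc)
  have "distinct r" using cyc_inj[OF f(1), of "Suc p"] by (simp add: r_def distinct_map del: upt_Suc)
  moreover have "set r \<subseteq> range f" by (auto simp: r_def)
  moreover have "successively (\<lambda>u v. {u, v} \<in> edges G) r"
    using cyc_edge[OF f(1)] by (auto simp: r_def successively_conv_nth simp del: upt_Suc)
  ultimately have "cyc G (length (r @ q)) (\<lambda>i. (r @ q) ! (i mod length (r @ q)))"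
    using q r Q(2) uv n
    by (intro cyc_of_list) (auto simp: successively_append_iff insert_commute)
  moreover have "(r @ q) ! (i mod length (r @ q)) \<in> set (r @ q)" for i
    using q by (intro nth_mem mod_less_divisor) simp
  moreover have "set (r @ q) \<subseteq> W" using \<open>set r \<subseteq> range f\<close> q f Q by auto
  moreover have "n < length (r @ q)" using r q by simp
  ultimately show ?thesis by blast
qed

text \<open>The attachments \<open>f p\<close> and \<open>f q\<close> form the side of size 2; the
  two arcs between them and \<open>Q\<close> form the other side. The bounds on \<open>q\<close> say
  that both arcs are nonempty.\<close>

lemma cyc_ear_minor:
  assumes G: "simple_graph G" and f: "cyc G n f"
    and pq: "Suc p < q" "Suc q < p + n"
    and Q: "conn G Q" "Q \<inter> range f = {}" "Q \<subseteq> verts G" "u \<in> Q" "v \<in> Q"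
    and uv: "{f p, u} \<in> edges G" "{f q, v} \<in> edges G"
  shows "is_minor (complete_bipartite 2 3) G"
proof -
  have last: "{f (p + n - 1), f p} \<in> edges G"
    using cyc_edge[OF f, of "p + n - 1"] cyc_period[OF f, of p] pq by simp
  have before: "{f (q - 1), f q} \<in> edges G"
    using cyc_edge[OF f, of "q - 1"] pq by simp
  have V: "f ` I \<subseteq> verts G" for I using cyc_verts[OF G f] by blast
  have dQ: "f ` I \<inter> Q = {}" for I using Q by blast
  show ?thesis
  proof (rule K23_minorI[OF G, of "f ` {p..<Suc p}" "f ` {q..<Suc q}" "f ` {Suc p..<q}" "f ` {Suc q..<p + n}" Q])
    show "adj G (f ` {p..<Suc p}) (f ` {Suc p..<q})"
      using pq cyc_edge[OF f, of p] by (intro adjI) auto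
    show "adj G (f ` {p..<Suc p}) (f ` {Suc q..<p + n})"
      using pq last by (intro adjI'[of "f p" _ "f (p + n - 1)"]) auto
    show "adj G (f ` {q..<Suc q}) (f ` {Suc p..<q})"
      using pq before by (intro adjI'[of "f q" _ "f (q - 1)"]) auto
    show "adj G (f ` {q..<Suc q}) (f ` {Suc q..<p + n})"
      using pq cyc_edge[OF f, of q] by (intro adjI) auto
    show "adj G (f ` {p..<Suc p}) Q" "adj G (f ` {q..<Suc q}) Q"
      using Q uv by (auto intro: adjI)
  qed ((rule cyc_conn[OF f] cyc_disjoint[OF f, of _ p] Q V dQ; use pq in auto)+)
qed

lemma cyc_crossing_gap_minor:
  assumes G: "simple_graph G" and f: "cyc G n f"
    and p: "Suc p1 < p2" "p2 < p3" "p3 < p4" "p4 < p1 + n"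
    and chords: "{f p1, f p3} \<in> edges G" "{f p2, f p4} \<in> edges G"
  shows "is_minor (complete_bipartite 2 3) G"
proof -
  have last: "{f (p1 + n - 1), f p1} \<in> edges G"
    using cyc_edge[OF f, of "p1 + n - 1"] cyc_period[OF f, of p1] p by simp
  have before: "{f (p2 - 1), f p2} \<in> edges G"
    using cyc_edge[OF f, of "p2 - 1"] p by simp
  have V: "f ` I \<subseteq> verts G" for I using cyc_verts[OF G f] by blast
  txt \<open>The ends \<open>f p1\<close> and \<open>f p2\<close> of the nonempty gap form the side of size 2.\<close>
  show ?thesis
  proof (rule K23_minorI[OF G, of "f ` {p1..<Suc p1}" "f ` {p2..<Suc p2}" "f ` {Suc p1..<p2}"
        "f ` {Suc p2..<Suc p3}" "f ` {p4..<p1 + n}"])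
    show "adj G (f ` {p1..<Suc p1}) (f ` {Suc p1..<p2})"
      using p cyc_edge[OF f, of p1] by (intro adjI) auto
    \<comment> \<open>Of the two arcs beyond the gap, one starts next to \<open>f p2\<close> and
      ends with \<open>f p3\<close>, the other starts with \<open>f p4\<close> and ends next to
      \<open>f p1\<close>. Each end of the gap thus reaches one of them along the cycle and the
      other by its chord.\<close>
    show "adj G (f ` {p1..<Suc p1}) (f ` {Suc p2..<Suc p3})"
      using p chords by (intro adjI[of "f p1" _ "f p3"]) auto
    show "adj G (f ` {p1..<Suc p1}) (f ` {p4..<p1 + n})"
      using p last by (intro adjI'[of "f p1" _ "f (p1 + n - 1)"]) auto
    show "adj G (f ` {p2..<Suc p2}) (f ` {Suc p1..<p2})"
      using p before by (intro adjI'[of "f p2" _ "f (p2 - 1)"]) auto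
    show "adj G (f ` {p2..<Suc p2}) (f ` {Suc p2..<Suc p3})"
      using p cyc_edge[OF f, of p2] by (intro adjI) auto
    show "adj G (f ` {p2..<Suc p2}) (f ` {p4..<p1 + n})"
      using p chords by (intro adjI[of "f p2" _ "f p4"]) auto
  qed ((rule cyc_conn[OF f] cyc_disjoint[OF f, of _ p1] V; use p in auto)+)
qed

text \<open>Among at least five positions, four cannot fill the cycle, so one of the four gaps
  contains a vertex; by periodicity the cycle is rotated to put this gap first. For
  \<open>n = 4\<close> the two chords would only give a K_4.\<close>

lemma cyc_crossing_minor:
  assumes G: "simple_graph G" and f: "cyc G n f" and n: "5 \<le> n"
    and p: "p1 < p2" "p2 < p3" "p3 < p4" "p4 < p1 + n"
    and chords: "{f p1, f p3} \<in> edges G" "{f p2, f p4} \<in> edges G"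
  shows "is_minor (complete_bipartite 2 3) G"
proof -
  note period = cyc_period[OF f] and gap = cyc_crossing_gap_minor[OF G f]
  consider "Suc p1 < p2" | "Suc p2 < p3" | "Suc p3 < p4" | "Suc p4 < p1 + n"
    using n p by linarith
  then show ?thesis
  proof cases
    case 1
    then show ?thesis using gap[of p1 p2 p3 p4] p chords by simp
  next
    case 2
    then show ?thesis using gap[of p2 p3 p4 "p1 + n"] p chords period[of p1]
      by (simp add: insert_commute)
  next
    case 3
    then show ?thesis using gap[of p3 p4 "p1 + n" "p2 + n"] p chords period[of p1] period[of p2]
      by (simp add: insert_commute)
  next
    case 4
    then show ?thesis using gap[of p4 "p1 + n" "p2 + n" "p3 + n"] p chords
        period[of p1] period[of p2] period[of p3]
      by (simp add: insert_commute)
  qed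
qed

section \<open>Spanning cycles of 2-connected sets\<close>

text \<open>\<open>W\<close> contains an edge, and cycles in \<open>W\<close> have length at most
  \<open>card W\<close>, so a longest one exists. A component of the rest attaches to it at some
  \<open>f p\<close> and, since deleting \<open>f p\<close> leaves \<open>W\<close> connected, also
  at some other \<open>f q\<close>.\<close>

lemma cyc_spanning:
  assumes G: "simple_graph G" "\<not> is_minor (complete_bipartite 2 3) G"
    and W: "finite W" "W \<subseteq> verts G" "2 \<le> card W" "\<And>Z v. Z \<subseteq> {v} \<Longrightarrow> conn G (W - Z)"
  shows "\<exists>n f. cyc G n f \<and> range f = W"
proof -
  have bound: "n \<le> card W" if "cyc G n f" "range f \<subseteq> W" for n f
  proof -
    have "card (f ` {0..<0 + n}) = n" using card_image[OF cyc_inj[OF that(1), of 0]] by simp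
    then have "card (range f) = n" using cyc_range[OF that(1), of 0] by simp
    then show ?thesis using card_mono[OF W(1) that(2)] by simp
  qed
  have connW: "conn G W" using W(4)[of "{}"] by simp
  have "\<exists>n f. cyc G n f \<and> range f \<subseteq> W"
  proof -
    obtain x y where xy: "x \<in> W" "y \<in> W" "x \<noteq> y"
      using W(1,3) by (metis card_le_Suc0_iff_eq not_less_eq_eq numeral_2_eq_2)
    obtain u v where "u \<in> W" "u \<in> {x}" "v \<in> W" "v \<notin> {x}" "{u, v} \<in> edges G"
      by (rule connD[OF connW, of x "{x}" y]) (use xy in simp_all)
    then have uv: "u \<in> W" "v \<in> W" "v \<noteq> u" "{u, v} \<in> edges G" by auto
    define g where "g = (\<lambda>i. [u, v] ! (i mod length [u, v]))"
    have "cyc G (length [u, v]) g"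
      unfolding g_def
    proof (rule cyc_of_list)
      show "{last [u, v], hd [u, v]} \<in> edges G" using uv(4) by (simp add: insert_commute)
    qed (use uv in simp_all)
    moreover have "g i \<in> set [u, v]" for i
      unfolding g_def by (intro nth_mem mod_less_divisor) simp
    then have "range g \<subseteq> W" using uv(1,2) by fastforce
    ultimately show ?thesis by blast
  qed
  then obtain k where k: "\<exists>f. cyc G k f \<and> range f \<subseteq> W" by blast
  have le: "m \<le> card W" if "\<exists>f. cyc G m f \<and> range f \<subseteq> W" for m
    using that bound by blast
  define n where "n = (GREATEST n. \<exists>f. cyc G n f \<and> range f \<subseteq> W)"
  have n: "\<exists>f. cyc G n f \<and> range f \<subseteq> W"
    unfolding n_def by (rule GreatestI_nat[where P = "\<lambda>n. \<exists>f. cyc G n f \<and> range f \<subseteq> W" and b = "card W"])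
      (fact k, rule le)
  have max: "m \<le> n" if "\<exists>f. cyc G m f \<and> range f \<subseteq> W" for m
    unfolding n_def by (rule Greatest_le_nat[where P = "\<lambda>n. \<exists>f. cyc G n f \<and> range f \<subseteq> W" and b = "card W"])
      (fact that, rule le)
  obtain f where f: "cyc G n f" "range f \<subseteq> W" using n by blast
  have no_longer: "\<nexists>m g. n < m \<and> cyc G m g \<and> range g \<subseteq> W"
    using max by (meson not_less)
  have "W \<subseteq> range f"
  proof (rule ccontr)
    assume "\<not> W \<subseteq> range f"
    then obtain w where w: "w \<in> W" "w \<notin> range f" by blast
    have "f 0 \<in> W" "f 0 \<in> range f" using f(2) by auto
    then obtain c v where "c \<in> range f" "v \<in> W" "v \<notin> range f" "{c, v} \<in> edges G"
      using connD[OF connW _ _ w] by metis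
    then obtain p where v: "v \<in> W" "v \<notin> range f" "{f p, v} \<in> edges G" by blast
    \<comment> \<open>\<open>Q\<close> is the component of \<open>v\<close> in
      \<open>W - range f\<close>; \<open>closed\<close> expresses its maximality.\<close>
    define Q where "Q = \<Union>{A. conn G A \<and> v \<in> A \<and> A \<subseteq> W - range f}"
    have Q: "conn G Q" unfolding Q_def by (rule conn_Union) blast
    have vQ: "v \<in> Q" unfolding Q_def using v conn_singleton[of G v] by blast
    have QW: "Q \<subseteq> W - range f" unfolding Q_def by blast
    have closed: "y \<in> Q" if "x \<in> Q" "y \<in> W - range f" "{x, y} \<in> edges G" for x y
    proof -
      have "conn G (Q \<union> {y})" using Q that by (intro conn_Un[where s = x and t = y]) (auto simp: conn_singleton)
      then show ?thesis using QW vQ that(2) unfolding Q_def by blast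
    qed
    \<comment> \<open>\<open>f (Suc p)\<close> serves as a vertex of \<open>W - {f p}\<close>
      outside \<open>Q\<close>. So an edge leaves \<open>Q\<close> while avoiding
      \<open>f p\<close>, and by \<open>closed\<close> it ends on the cycle.\<close>
    have "f (Suc p) \<noteq> f p"
      using inj_on_eq_iff[OF cyc_inj[OF f(1), of p], of "Suc p" p] f(1) by (simp add: cyc_def)
    then have "f (Suc p) \<in> W - {f p}" "f (Suc p) \<notin> Q" "v \<in> W - {f p}"
      using f(2) QW v by auto
    then obtain u w where uw: "u \<in> Q" "w \<in> W - {f p}" "w \<notin> Q" "{u, w} \<in> edges G"
      using connD[OF W(4)[OF subset_refl] _ vQ] by metis
    then obtain q where q: "w = f q" "q \<in> {p..<p + n}"
      using closed[of u w] cyc_range[OF f(1), of p] by blast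
    have "q \<noteq> p" using q uw by blast
    have Q': "Q \<inter> range f = {}" "Q \<subseteq> W" using QW by auto
    have u: "{f q, u} \<in> edges G" using uw(4) q(1) by (simp add: insert_commute)
    \<comment> \<open>In the window starting at \<open>p\<close>, either \<open>f q\<close> is the
      successor of \<open>f p\<close>, or its predecessor, or both arcs between them have inner
      vertices.\<close>
    consider "q = Suc p" | "Suc q = p + n" | "Suc p < q" "Suc q < p + n"
      using q(2) \<open>q \<noteq> p\<close> by fastforce
    then show False
    proof cases
      case 1
      then have "{f (Suc p), u} \<in> edges G" using u by simp
      then show False
        using cyc_extend[OF f Q Q' vQ uw(1) v(3)] no_longer by metis
    next
      case 2
      then have "{f (Suc q), v} \<in> edges G" using cyc_period[OF f(1), of p] v(3) by simp
      then show False
        using cyc_extend[OF f Q Q' uw(1) vQ u] no_longer by metis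
    next
      case 3
      then show False
        using cyc_ear_minor[OF G(1) f(1) 3 Q Q'(1) _ vQ uw(1) v(3) u] Q'(2) W(2) G(2) by blast
    qed
  qed
  then show ?thesis using f by blast
qed

text \<open>An edge of \<open>T\<close> leaves the open arc from \<open>q1\<close> to
  \<open>q3\<close>. As \<open>T\<close> avoids the ends of this arc, the edge is a chord separating
  \<open>f q1\<close> from \<open>f q3\<close> on the cycle. In the same way \<open>S\<close> has an
  edge leaving the open arc cut off by that chord, and the two chords cross.\<close>

lemma cyc_no_crossing:
  assumes G: "simple_graph G" "\<not> is_minor (complete_bipartite 2 3) G"
    and f: "cyc G n f" and n: "5 \<le> n"
    and q: "q1 < q2" "q2 < q3" "q3 < q4" "q4 < q1 + n"
    and ST: "conn G S" "conn G T" "S \<subseteq> range f" "T \<subseteq> range f" "S \<inter> T = {}"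
    and mem: "f q1 \<in> S" "f q3 \<in> S" "f q2 \<in> T" "f q4 \<in> T"
  shows False
proof -
  have eq: "f i = f j \<longleftrightarrow> i = j" if "i \<in> {p..<p + n}" "j \<in> {p..<p + n}" for i j p
    using cyc_inj[OF f, of p] that by (auto simp: inj_on_def)
  have "f q4 \<notin> f ` {q1<..<q3}" using q by (auto simp: eq[of _ q1])
  moreover have "f q2 \<in> f ` {q1<..<q3}" using q by simp
  ultimately obtain u v where uv: "u \<in> T" "u \<in> f ` {q1<..<q3}" "v \<in> T" "v \<notin> f ` {q1<..<q3}" "{u, v} \<in> edges G"
    using connD[OF ST(2) mem(3) _ mem(4)] by metis
  obtain i where i: "u = f i" "q1 < i" "i < q3" using uv by auto
  obtain j where j: "v = f j" "j \<in> {q1..<q1 + n}"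
    using uv ST(4) cyc_range[OF f, of q1] by blast
  have "j \<noteq> q1" "j \<noteq> q3" using j uv mem ST(5) by auto
  moreover have "\<not> (q1 < j \<and> j < q3)" using uv(4) j by auto
  ultimately have j': "q3 < j" "j < q1 + n" using j by auto
  have "f q1 \<notin> f ` {i<..<j}" using i j' by (auto simp: eq[of _ q1])
  moreover have "f q3 \<in> f ` {i<..<j}" using i j' by simp
  ultimately obtain a b where ab: "a \<in> S" "a \<in> f ` {i<..<j}" "b \<in> S" "b \<notin> f ` {i<..<j}" "{a, b} \<in> edges G"
    using connD[OF ST(1) mem(2) _ mem(1)] by metis
  obtain k where k: "a = f k" "i < k" "k < j" using ab by auto
  \<comment> \<open>The window is cut open at \<open>i\<close> this time, so that the end of the
    edge outside the arc gets a position after \<open>j\<close>.\<close>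
  obtain l where l: "b = f l" "l \<in> {i..<i + n}"
    using ab ST(3) cyc_range[OF f, of i] by blast
  have "l \<noteq> i" "l \<noteq> j" using l i j ab uv ST(5) by auto
  moreover have "\<not> (i < l \<and> l < j)" using ab(4) l by auto
  ultimately have "j < l" "l < i + n" using l by auto
  then show False
    using cyc_crossing_minor[OF G(1) f n, of i k j l] G(2) uv ab i j k l by simp
qed

section \<open>Separations by at most one vertex\<close>

lemma separated_conn_meets:
  assumes "conn G S" "S \<subseteq> A \<union> B \<union> Z" "\<And>a b. a \<in> A \<Longrightarrow> b \<in> B \<Longrightarrow> {a, b} \<notin> edges G"
    and "a \<in> S" "a \<in> A" "b \<in> S" "b \<in> B" "A \<inter> B = {}"
  shows "S \<inter> Z \<noteq> {}"
proof -
  have "b \<notin> A" using assms by blast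
  then obtain u w where "u \<in> S" "u \<in> A" "w \<in> S" "w \<notin> A" "{u, w} \<in> edges G"
    using connD[OF assms(1,4,5,6)] by blast
  then show ?thesis using assms(2,3) by blast
qed

text \<open>As \<open>Z\<close> has at most one vertex, one of the two parts of any cut of
  \<open>S - A\<close> misses \<open>Z\<close> and hence lies in \<open>B\<close>. The edge of
  \<open>S\<close> leaving that part cannot end in \<open>A\<close>, so it crosses the cut inside
  \<open>S - A\<close>.\<close>

lemma separated_conn_diff:
  assumes S: "conn G S" "S \<subseteq> A \<union> B \<union> Z" and Z: "Z \<subseteq> {v}"
    and no: "\<And>a b. a \<in> A \<Longrightarrow> b \<in> B \<Longrightarrow> {a, b} \<notin> edges G"
  shows "conn G (S - A)"
  unfolding conn_def
proof (intro allI impI)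
  fix P assume P: "P \<subseteq> S - A" "P \<noteq> {}" "P \<noteq> S - A"
  have step: "\<exists>u\<in>R. \<exists>w\<in>S - A - R. {u, w} \<in> edges G"
    if R: "R \<subseteq> S - A" "R \<noteq> {}" "R \<noteq> S - A" "R \<inter> Z = {}" for R
  proof -
    obtain u w where uw: "u \<in> R" "w \<in> S" "w \<notin> R" "{u, w} \<in> edges G"
      using R S(1) unfolding conn_def by (metis DiffE Diff_subset order.trans psubsetI psubset_imp_ex_mem subset_antisym)
    have "u \<in> B" using uw(1) R S(2) by blast
    then have "w \<notin> A" using no[of w u] uw(4) by (metis insert_commute)
    then show ?thesis using uw by blast
  qed
  show "\<exists>a\<in>P. \<exists>b\<in>S - A - P. {a, b} \<in> edges G"
  proof (cases "P \<inter> Z = {}")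
    case True
    then show ?thesis using step P by blast
  next
    case False
    then have "\<exists>u\<in>S - A - P. \<exists>w\<in>S - A - (S - A - P). {u, w} \<in> edges G"
      using P Z by (intro step) auto
    then show ?thesis by (metis DiffD1 DiffD2 DiffI insert_commute)
  qed
qed

text \<open>The carrier \<open>W\<close> is a parameter because the minimality argument shrinks it,
  possibly exchanging a vertex of \<open>Y\<close> on the way.\<close>

definition splittable :: "'a ugraph \<Rightarrow> 'a set \<Rightarrow> 'a set \<Rightarrow> bool" where
  "splittable G W Y \<longleftrightarrow> Y \<subseteq> W \<and> card Y = 5 \<and>
     (\<forall>A. A \<subseteq> Y \<longrightarrow> card A = 2 \<longrightarrow>
       (\<exists>S T. S \<subseteq> W \<and> T \<subseteq> W \<and> S \<inter> T = {} \<and> conn G S \<and> conn G T \<and> A \<subseteq> S \<and> Y - A \<subseteq> T))"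

lemma splittableI:
  assumes "Y \<subseteq> W" "card Y = 5"
    and "\<And>E. E \<subseteq> Y \<Longrightarrow> card E = 2 \<Longrightarrow>
      \<exists>S T. S \<subseteq> W \<and> T \<subseteq> W \<and> S \<inter> T = {} \<and> conn G S \<and> conn G T \<and> E \<subseteq> S \<and> Y - E \<subseteq> T"
  shows "splittable G W Y"
  using assms unfolding splittable_def by simp

lemma splittableD:
  assumes "splittable G W Y" "E \<subseteq> Y" "card E = 2"
  obtains S T where "S \<subseteq> W" "T \<subseteq> W" "S \<inter> T = {}" "conn G S" "conn G T" "E \<subseteq> S" "Y - E \<subseteq> T"
  using assms unfolding splittable_def by meson

lemma splittable_pairD:
  assumes "splittable G W Y" "a \<in> Y" "b \<in> Y" "a \<noteq> b"
  obtains S T where "S \<subseteq> W" "T \<subseteq> W" "S \<inter> T = {}" "conn G S" "conn G T" "a \<in> S" "b \<in> S" "Y - {a, b} \<subseteq> T"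
proof -
  have "{a, b} \<subseteq> Y" "card {a, b} = 2" using assms by auto
  then obtain S T where "S \<subseteq> W" "T \<subseteq> W" "S \<inter> T = {}" "conn G S" "conn G T" "{a, b} \<subseteq> S" "Y - {a, b} \<subseteq> T"
    using splittableD[OF assms(1)] by metis
  then show thesis using that[of S T] by simp
qed

text \<open>Removing \<open>A\<close> keeps the two sets of each splitting connected. If
  \<open>Y\<close> has a vertex \<open>x\<close> in \<open>A\<close>, then every connected set in
  \<open>W\<close> joining \<open>x\<close> to another vertex of \<open>Y\<close> passes through
  \<open>v\<close>, so \<open>v\<close> can take the place of \<open>x\<close>.\<close>

lemma splittable_reduce:
  assumes Y: "splittable G W Y"
    and W: "W = A \<union> B \<union> Z" "Z \<subseteq> {v}" "A \<inter> B = {}" "A \<inter> Z = {}" "B \<inter> Z = {}"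
    and no: "\<And>a b. a \<in> A \<Longrightarrow> b \<in> B \<Longrightarrow> {a, b} \<notin> edges G"
    and one: "card (Y \<inter> A) \<le> 1"
  shows "\<exists>Y'. splittable G (W - A) Y'"
proof -
  have Y5: "Y \<subseteq> W" "card Y = 5" "finite Y"
    using Y by (auto simp: splittable_def intro: card_ge_0_finite)
  note diff = separated_conn_diff[OF _ _ W(2) no]
  show ?thesis
  proof (cases "Y \<inter> A = {}")
    case True
    have "\<exists>S T. S \<subseteq> W - A \<and> T \<subseteq> W - A \<and> S \<inter> T = {} \<and> conn G S \<and> conn G T \<and> E \<subseteq> S \<and> Y - E \<subseteq> T"
      if E: "E \<subseteq> Y" "card E = 2" for E
    proof -
      obtain S T where "S \<subseteq> W" "T \<subseteq> W" "S \<inter> T = {}" "conn G S" "conn G T" "E \<subseteq> S" "Y - E \<subseteq> T"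
        using splittableD[OF Y E] by metis
      then show ?thesis using True E diff[of S] diff[of T] W(1)
        by (intro exI[of _ "S - A"] exI[of _ "T - A"]) auto
    qed
    moreover have "Y \<subseteq> W - A" using True Y5(1) by blast
    ultimately show ?thesis using Y5(2) splittableI by metis
  next
    case False
    then have "card (Y \<inter> A) = 1" using one Y5(3) by (simp add: card_gt_0_iff le_Suc_eq)
    then obtain x where x: "Y \<inter> A = {x}" by (auto simp: card_1_singleton_iff)
    \<comment> \<open>A third vertex \<open>b\<close> of \<open>Y\<close> lies in \<open>B\<close>,
      and the set containing \<open>x\<close> and \<open>b\<close> must pass through
      \<open>v\<close>. If \<open>v\<close> were in \<open>Y\<close>, it would belong to the
      opposite set \<open>T\<close>.\<close>
    have "Z \<noteq> {} \<and> v \<notin> Y"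
    proof -
      have "card (Y - {x} - {v}) \<ge> 3" using Y5 by (auto simp: card_Diff_singleton_if)
      then obtain b where b: "b \<in> Y" "b \<noteq> x" "b \<noteq> v" by (metis Diff_iff card.empty ex_in_conv not_numeral_le_zero singletonI)
      have bB: "b \<in> B" using b x Y5(1) W by blast
      have xA: "x \<in> Y" "x \<in> A" using x by auto
      obtain S T where S: "S \<subseteq> W" "S \<inter> T = {}" "conn G S" "x \<in> S" "b \<in> S" "Y - {x, b} \<subseteq> T"
        using splittable_pairD[OF Y xA(1) b(1)] b by metis
      have "S \<inter> Z \<noteq> {}"
        using separated_conn_meets[OF S(3) _ no S(4) xA(2) S(5) bB W(3)] S(1) W(1) by blast
      then have "v \<in> S" "v \<in> Z" using W(2) by auto
      moreover have "v \<noteq> x" using \<open>v \<in> Z\<close> xA W by blast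
      ultimately show ?thesis using S b by blast
    qed
    then have v: "Z = {v}" "v \<notin> Y" using W(2) by auto
    define Y' where "Y' = insert v (Y - {x})"
    have YB: "Y - {x} \<subseteq> B" using x v Y5(1) W(1) by blast
    have xA: "x \<in> Y" "x \<in> A" using x by auto
    have cross: "v \<in> S" if "conn G S" "S \<subseteq> W" "x \<in> S" "b \<in> S" "b \<in> Y - {x}" for S b
      using separated_conn_meets[OF that(1) _ no that(3) xA(2) that(4) _ W(3), of Z] that YB W(1) v by auto
    have "\<exists>S T. S \<subseteq> W - A \<and> T \<subseteq> W - A \<and> S \<inter> T = {} \<and> conn G S \<and> conn G T \<and> E \<subseteq> S \<and> Y' - E \<subseteq> T"
      if E: "E \<subseteq> Y'" "card E = 2" for E
    proof -
      \<comment> \<open>\<open>E'\<close> is \<open>E\<close> with the exchange of \<open>x\<close>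
        for \<open>v\<close> undone. Both \<open>E'\<close> and \<open>Y - E'\<close> have a vertex
        other than \<open>x\<close>, so by \<open>cross\<close> whichever set contains
        \<open>x\<close> also contains \<open>v\<close>.\<close>
      define E' where "E' = (if v \<in> E then insert x (E - {v}) else E)"
      have fE: "finite E" using E by (simp add: card_ge_0_finite)
      have E': "E' \<subseteq> Y" "card E' = 2"
        using E xA fE v unfolding E'_def Y'_def by (auto simp: card_insert_if card_Diff_singleton_if)
      have two: "\<exists>b. b \<in> D \<and> b \<noteq> x" if "card D \<ge> 2" for D
        using that by (metis card_le_Suc0_iff_eq card_ge_0_finite not_less_eq_eq numeral_2_eq_2 zero_less_numeral order_less_le_trans)
      have "card (Y - E') = 3" using E' Y5 by (simp add: card_Diff_subset finite_subset)
      then obtain b where b: "b \<in> Y - E'" "b \<noteq> x" using two[of "Y - E'"] by auto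
      obtain a where a: "a \<in> E'" "a \<noteq> x" using two[of E'] E' by auto
      obtain S T where ST: "S \<subseteq> W" "T \<subseteq> W" "S \<inter> T = {}" "conn G S" "conn G T" "E' \<subseteq> S" "Y - E' \<subseteq> T"
        using splittableD[OF Y E'] by metis
      have "v \<in> E \<Longrightarrow> v \<in> S"
        using cross[OF ST(4,1) _ , of a] ST(6) a E' unfolding E'_def by auto
      moreover have "v \<notin> E \<Longrightarrow> v \<in> T"
        using cross[OF ST(5,2) _ , of b] ST(7) b E' E xA x YB W(3) v(2) unfolding E'_def Y'_def by auto
      moreover have "E - {v} \<subseteq> S" using ST(6) unfolding E'_def by (auto split: if_splits)
      moreover have "Y' - E - {v} \<subseteq> T" using ST(7) unfolding E'_def Y'_def by (auto split: if_splits)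
      moreover have "Y' \<inter> A = {}" using YB W v unfolding Y'_def by auto
      ultimately have "E \<subseteq> S - A" "Y' - E \<subseteq> T - A" using E(1) by blast+
      then show ?thesis using ST diff[of S] diff[of T] W(1)
        by (intro exI[of _ "S - A"] exI[of _ "T - A"]) auto
    qed
    moreover have "Y' \<subseteq> W - A" using YB W v unfolding Y'_def by auto
    moreover have "card Y' = 5" using v xA Y5 unfolding Y'_def by (simp add: card_Diff_singleton_if)
    ultimately show ?thesis using splittableI by metis
  qed
qed

text \<open>With two vertices of \<open>Y\<close> on each side, one from each side is put into
  \<open>S\<close>, leaving one from each side in \<open>T\<close>. Both sets must then meet
  \<open>Z\<close>, which offers only one vertex.\<close>

lemma splittable_one_side:
  assumes Y: "splittable G W Y"
    and W: "W = A \<union> B \<union> Z" "Z \<subseteq> {v}" "A \<inter> B = {}"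
    and no: "\<And>a b. a \<in> A \<Longrightarrow> b \<in> B \<Longrightarrow> {a, b} \<notin> edges G"
  shows "card (Y \<inter> A) \<le> 1 \<or> card (Y \<inter> B) \<le> 1"
proof (rule ccontr)
  assume "\<not> ?thesis"
  moreover have "finite Y" using Y by (auto simp: splittable_def intro: card_ge_0_finite)
  ultimately obtain a a' b b' where "a \<in> Y \<inter> A" "a' \<in> Y \<inter> A" "a \<noteq> a'" "b \<in> Y \<inter> B" "b' \<in> Y \<inter> B" "b \<noteq> b'"
    by (auto simp: card_le_Suc0_iff_eq)
  then have ab: "a \<in> Y" "a \<in> A" "a' \<in> Y" "a' \<in> A" "a \<noteq> a'" "b \<in> Y" "b \<in> B" "b' \<in> Y" "b' \<in> B" "b \<noteq> b'"
    by auto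
  then have ne: "a \<noteq> b" "a' \<notin> {a, b}" "b' \<notin> {a, b}" using W(3) by auto
  obtain S T where ST: "S \<subseteq> W" "T \<subseteq> W" "S \<inter> T = {}" "conn G S" "conn G T" "a \<in> S" "b \<in> S" "Y - {a, b} \<subseteq> T"
    using splittable_pairD[OF Y ab(1,6) ne(1)] by metis
  have T: "a' \<in> T" "b' \<in> T" using ST(8) ab ne by auto
  have "S \<inter> Z \<noteq> {}" "T \<inter> Z \<noteq> {}"
    using separated_conn_meets[OF ST(4) _ no ST(6) ab(2) ST(7) ab(7) W(3), of Z]
      separated_conn_meets[OF ST(5) _ no T(1) ab(4) T(2) ab(9) W(3), of Z] ST(1,2) W(1) by auto
  then show False using W(2) ST(3) by blast
qed

lemma splittable_minimal_conn:
  assumes Y: "splittable G W Y" and min: "\<And>W' Y'. W' \<subset> W \<Longrightarrow> \<not> splittable G W' Y'"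
    and Z: "Z \<subseteq> {v}"
  shows "conn G (W - Z)"
proof (rule ccontr)
  assume "\<not> conn G (W - Z)"
  then obtain A where A: "A \<subseteq> W - Z" "A \<noteq> {}" "A \<noteq> W - Z"
    and no: "\<And>a b. a \<in> A \<Longrightarrow> b \<in> W - Z - A \<Longrightarrow> {a, b} \<notin> edges G"
    unfolding conn_def by blast
  define B where "B = W - Z - A"
  \<comment> \<open>\<open>Z\<close> need not lie in \<open>W\<close>, so the separator is
    \<open>Z \<inter> W\<close>. Both orders of \<open>A\<close> and \<open>B\<close> are recorded
    because either may be the side to delete.\<close>
  have B: "B \<noteq> {}" "W = A \<union> B \<union> (Z \<inter> W)" "W = B \<union> A \<union> (Z \<inter> W)" "Z \<inter> W \<subseteq> {v}" "A \<inter> B = {}" "B \<inter> A = {}"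
    "A \<inter> (Z \<inter> W) = {}" "B \<inter> (Z \<inter> W) = {}"
    using A Z unfolding B_def by auto
  have no: "{a, b} \<notin> edges G" "{b, a} \<notin> edges G" if "a \<in> A" "b \<in> B" for a b
    using no that unfolding B_def by (auto simp: insert_commute)
  have "card (Y \<inter> A) \<le> 1 \<or> card (Y \<inter> B) \<le> 1"
    using splittable_one_side[OF Y B(2,4,5) no(1)] by blast
  then show False
    using splittable_reduce[OF Y B(2,4,5,7,8) no(1)] splittable_reduce[OF Y B(3,4,6,8,7) no(2)]
      min[of "W - A"] min[of "W - B"] A B(1,2) by blast
qed

section \<open>From agile sets to the minor\<close>

text \<open>Strong induction supplies the minimality: as long as no minor exists, no proper subset
  of \<open>W\<close> is splittable, whatever the 5-set.\<close>

lemma splittable_minor: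
  assumes G: "simple_graph G" and W: "finite W" "W \<subseteq> verts G" and Y: "splittable G W Y"
  shows "is_minor (complete_bipartite 2 3) G"
  using W Y
proof (induction "card W" arbitrary: W Y rule: less_induct)
  case less
  show ?case
  proof (rule ccontr)
    assume K: "\<not> is_minor (complete_bipartite 2 3) G"
    have min: "\<not> splittable G W' Y'" if "W' \<subset> W" for W' Y'
      using less.hyps[of W' Y'] that less.prems(1,2) K
      by (metis finite_subset order.trans psubset_card_mono psubset_imp_subset)
    have Y: "Y \<subseteq> W" "card Y = 5" using less.prems(3) by (auto simp: splittable_def)
    then have W5: "5 \<le> card W" using less.prems(1) by (metis card_mono)
    have "conn G (W - Z)" if "Z \<subseteq> {v}" for Z v
      using splittable_minimal_conn[OF less.prems(3) min that] .
    then obtain n f where f: "cyc G n f" "range f = W"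
      using cyc_spanning[OF G K less.prems(1,2)] W5 by fastforce
    have inj: "inj_on f {0..<n}" and img: "f ` {0..<n} = W"
      using cyc_inj[OF f(1), of 0] cyc_range[OF f(1), of 0] f(2) by auto
    then have n: "5 \<le> n" using W5 card_image[OF inj] by simp
    define I where "I = {i \<in> {0..<n}. f i \<in> Y}"
    have "f ` I = Y" using img Y unfolding I_def by auto
    moreover have "inj_on f I" using inj by (rule inj_on_subset) (auto simp: I_def)
    ultimately have "card I = 5" using Y by (metis card_image)
    moreover define xs where "xs = sorted_list_of_set I"
    ultimately have "length xs = 5" "sorted_wrt (<) xs" "set xs = I"
      by (auto simp: I_def)
    then obtain q1 q2 q3 q4 q5 where "q1 < q2" "q2 < q3" "q3 < q4" "q4 < q5" "{q1, q2, q3, q4, q5} = I"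
      by (auto simp: eval_nat_numeral length_Suc_conv)
    then have q: "q1 < q2" "q2 < q3" "q3 < q4" "q4 < n" "f q1 \<in> Y" "f q2 \<in> Y" "f q3 \<in> Y" "f q4 \<in> Y"
      unfolding I_def by auto
    then have ne: "f q1 \<noteq> f q3" "f q2 \<notin> {f q1, f q3}" "f q4 \<notin> {f q1, f q3}"
      using inj by (auto simp: inj_on_eq_iff)
    obtain S T where ST: "S \<subseteq> W" "T \<subseteq> W" "S \<inter> T = {}" "conn G S" "conn G T" "f q1 \<in> S" "f q3 \<in> S"
      "Y - {f q1, f q3} \<subseteq> T"
      \<comment> \<open>Splitting off the alternate vertices \<open>f q1\<close> and
        \<open>f q3\<close> leaves \<open>f q2\<close> and \<open>f q4\<close> in \<open>T\<close>,
        so \<open>S\<close> and \<open>T\<close> cross on the cycle.\<close>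
      using splittable_pairD[OF less.prems(3) q(5,7) ne(1)] by metis
    then show False
      using cyc_no_crossing[OF G K f(1) n q(1-3), of S T] q ne f(2) by auto
  qed
qed

text \<open>\<open>W\<close> is the union of \<open>X\<close> and of finite connected sets chosen
  inside the trees for each of the finitely many pairs in \<open>X\<close>. Both classes are
  nonempty, so \<open>empty_graph\<close> does not occur as a witness.\<close>

lemma agile_splittable:
  assumes X: "agile G X" "card X = 5"
  shows "\<exists>W. finite W \<and> W \<subseteq> verts G \<and> splittable G W X"
proof -
  have fX: "finite X" using X by (simp add: card_ge_0_finite)
  have tree: "\<exists>F. finite F \<and> B \<subseteq> F \<and> F \<subseteq> verts T \<and> conn G F"
    if "subgraph T G" "is_tree T \<or> B = {} \<and> T = empty_graph" "B \<subseteq> verts T" "B \<noteq> {}" "finite B" for B T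
    using conn_finite_subset[of T G B] that unfolding subgraph_def is_tree_def by blast
  have "\<exists>S T. finite S \<and> finite T \<and> S \<subseteq> verts G \<and> T \<subseteq> verts G \<and> S \<inter> T = {} \<and> conn G S \<and> conn G T
      \<and> A \<subseteq> S \<and> X - A \<subseteq> T" if A: "A \<in> {A. A \<subseteq> X \<and> card A = 2}" for A
  proof -
    have fA: "finite A" using A fX by (auto intro: finite_subset)
    have "card (X - A) = 3" using A X fA by (simp add: card_Diff_subset)
    then have ne: "A \<noteq> {}" "X - A \<noteq> {}" using A by auto
    have "A \<union> (X - A) = X" "A \<inter> (X - A) = {}" using A by auto
    then have "independent_pair G A (X - A)" using X unfolding agile_def by blast
    then obtain T1 T2 where T: "subgraph T1 G" "subgraph T2 G"
      "is_tree T1 \<or> A = {} \<and> T1 = empty_graph" "is_tree T2 \<or> X - A = {} \<and> T2 = empty_graph"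
      "verts T1 \<inter> verts T2 = {}" "A \<subseteq> verts T1" "X - A \<subseteq> verts T2"
      unfolding independent_pair_def by blast
    obtain S where S: "finite S" "A \<subseteq> S" "S \<subseteq> verts T1" "conn G S"
      using tree[OF T(1,3,6) ne(1) fA] by blast
    obtain R where R: "finite R" "X - A \<subseteq> R" "R \<subseteq> verts T2" "conn G R"
      using tree[OF T(2,4,7) ne(2)] fX by blast
    have "verts T1 \<subseteq> verts G" "verts T2 \<subseteq> verts G" using T(1,2) by (auto simp: subgraph_def)
    then have "S \<subseteq> verts G" "R \<subseteq> verts G" "S \<inter> R = {}" using S R T(5) by blast+
    then show ?thesis using S R by blast
  qed
  then have "\<forall>A\<in>{A. A \<subseteq> X \<and> card A = 2}. \<exists>S T. finite S \<and> finite T \<and> S \<subseteq> verts G \<and> T \<subseteq> verts G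
      \<and> S \<inter> T = {} \<and> conn G S \<and> conn G T \<and> A \<subseteq> S \<and> X - A \<subseteq> T" by (rule ballI)
  from bchoice[OF this] obtain S where "\<forall>A\<in>{A. A \<subseteq> X \<and> card A = 2}. \<exists>T. finite (S A) \<and> finite T
      \<and> S A \<subseteq> verts G \<and> T \<subseteq> verts G \<and> S A \<inter> T = {} \<and> conn G (S A) \<and> conn G T \<and> A \<subseteq> S A \<and> X - A \<subseteq> T" ..
  from bchoice[OF this] obtain T where ST: "\<forall>A\<in>{A. A \<subseteq> X \<and> card A = 2}. finite (S A) \<and> finite (T A)
      \<and> S A \<subseteq> verts G \<and> T A \<subseteq> verts G \<and> S A \<inter> T A = {} \<and> conn G (S A) \<and> conn G (T A)
      \<and> A \<subseteq> S A \<and> X - A \<subseteq> T A" ..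
  define W where "W = X \<union> (\<Union>A\<in>{A. A \<subseteq> X \<and> card A = 2}. S A \<union> T A)"
  have "finite {A. A \<subseteq> X \<and> card A = 2}" using fX by simp
  then have "finite W" unfolding W_def using fX ST by blast
  moreover have "S A \<union> T A \<subseteq> verts G" if "A \<in> {A. A \<subseteq> X \<and> card A = 2}" for A
    using bspec[OF ST that] by simp
  then have "W \<subseteq> verts G" using X(1) unfolding W_def agile_def by (simp only: Un_subset_iff UN_subset_iff) simp
  moreover have "splittable G W X"
  proof (rule splittableI)
    fix A assume A: "A \<subseteq> X" "card A = 2"
    then have "S A \<subseteq> W" "T A \<subseteq> W" unfolding W_def by auto
    then show "\<exists>S T. S \<subseteq> W \<and> T \<subseteq> W \<and> S \<inter> T = {} \<and> conn G S \<and> conn G T \<and> A \<subseteq> S \<and> X - A \<subseteq> T"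
      using bspec[OF ST, of A] A by blast
  qed (use X in \<open>auto simp: W_def\<close>)
  ultimately show ?thesis by blast
qed

theorem proposition3p1:
  fixes G :: "'a ugraph"
  assumes "simple_graph G"
    and "\<not> is_minor (complete_bipartite 2 3) G"
  shows "\<not> (\<exists>X. agile G X \<and> card X = 5)"
  using assms agile_splittable splittable_minor by metis

end
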